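(* For every $\alpha \in (0,\pi/2)$ and every $x \in (0,\alpha)$, we have $$(\cos \alpha)^{\frac{x^2}{\alpha^2}} \;\leq\; (\cos \alpha)^{\frac{x^4}{\alpha^4}}\, e^{\frac{x^4-\alpha^2 x^2}{2\alpha^2}} \;\leq\; \cos x \;\leq\; e^{-x^2/2}.$$
   Context: All powers are real powers of positive real numbers. *)

theory Defs
  imports Complex_Main
begin

end

theory Submission
  imports Defs
begin

text \<open>Put \<open>g x = - ln (cos x) - x^2 / 2\<close>. In the Taylor series
  \<open>- ln (cos x) = x^2 / 2 + x^4 / 12 + ...\<close> all coefficients are nonnegative, so one expects
  \<open>g \<ge> 0\<close> and that \<open>g x / x^4\<close> increases. These two facts are the whole theorem. After taking
  logarithms, the third inequality is \<open>g x \<ge> 0\<close>; with \<open>s = (x / \<alpha>)^2\<close> the first one is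
  \<open>s * (1 - s) * g \<alpha> \<ge> 0\<close>, and the middle one is \<open>g x \<le> s^2 * g \<alpha>\<close>, which says that
  \<open>g x / x^4 \<le> g \<alpha> / \<alpha>^4\<close>.

  The series is avoided by differentiating. The sign of the derivative of \<open>g x / x^4\<close> is that of
  \<open>x * (tan x - x) - 4 * g x\<close>. This expression vanishes at \<open>0\<close>, and so does its derivative
  \<open>x * (tan x)^2 - 3 * (tan x - x)\<close>; the second derivative is
  \<open>2 * tan x * (x / (cos x)^2 - tan x)\<close>, which is nonnegative because \<open>sin x * cos x \<le> x\<close>.\<close>

lemma nonneg_if_deriv_nonneg:
  fixes F :: "real \<Rightarrow> real"
  assumes "F 0 = 0" "0 \<le> x" "x < b"
    and "\<And>y. 0 \<le> y \<Longrightarrow> y < b \<Longrightarrow> (F has_real_derivative F' y) (at y)"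
    and "\<And>y. 0 \<le> y \<Longrightarrow> y < b \<Longrightarrow> F' y \<ge> 0"
  shows "F x \<ge> 0"
  using DERIV_nonneg_imp_nondecreasing[of 0 x F] assms by fastforce

definition neg_ln_cos_remainder :: "real \<Rightarrow> real" where
  "neg_ln_cos_remainder x = - ln (cos x) - x^2 / 2"

lemma tan_nonneg_0_pi_half:
  fixes x :: real
  assumes "0 \<le> x" "x < pi/2"
  shows "tan x \<ge> 0"
  using assms tan_gt_zero[of x] by (cases "x = 0") auto

lemma cos_pos_0_pi_half:
  fixes x :: real
  assumes "0 \<le> x" "x < pi/2"
  shows "cos x > 0"
  using assms by (intro cos_gt_zero_pi) auto

lemma inverse_cos_squared:
  fixes x :: real
  assumes "cos x \<noteq> 0"
  shows "inverse ((cos x)^2) = 1 + (tan x)^2"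
  using tan_sec[OF assms] by (simp add: power_inverse)

lemma le_tan:
  fixes x :: real
  assumes "0 \<le> x" "x < pi/2"
  shows "x \<le> tan x"
proof -
  have "tan x - x \<ge> 0"
  proof (rule nonneg_if_deriv_nonneg[where x = x and b = "pi/2" and F' = "\<lambda>y. (tan y)^2"])
    fix y :: real assume "0 \<le> y" "y < pi/2"
    then have "cos y \<noteq> 0" using cos_pos_0_pi_half[of y] by simp
    then show "((\<lambda>y. tan y - y) has_real_derivative (tan y)^2) (at y)"
      by (auto intro!: derivative_eq_intros simp: inverse_cos_squared)
  qed (use assms in auto)
  then show ?thesis by simp
qed

lemma DERIV_neg_ln_cos_remainder:
  assumes "0 \<le> x" "x < pi/2"
  shows "(neg_ln_cos_remainder has_real_derivative tan x - x) (at x)"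
  unfolding neg_ln_cos_remainder_def [abs_def] using cos_pos_0_pi_half[OF assms]
  by (auto intro!: derivative_eq_intros simp: tan_def)

lemma neg_ln_cos_remainder_nonneg:
  assumes "0 \<le> x" "x < pi/2"
  shows "neg_ln_cos_remainder x \<ge> 0"
  by (rule nonneg_if_deriv_nonneg[where F = neg_ln_cos_remainder and x = x and b = "pi/2"
        and F' = "\<lambda>y. tan y - y"])
     (use assms le_tan DERIV_neg_ln_cos_remainder in \<open>auto simp: neg_ln_cos_remainder_def\<close>)

lemma tan_le_mult_sec_squared:
  fixes x :: real
  assumes "0 \<le> x" "x < pi/2"
  shows "tan x \<le> x * (1 + (tan x)^2)"
proof -
  have c: "cos x > 0" using assms by (rule cos_pos_0_pi_half)
  have "sin x * cos x \<le> x * 1"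
    using assms c sin_x_le_x[of x] by (intro mult_mono) auto
  then have "sin x * cos x / (cos x)^2 \<le> x / (cos x)^2"
    by (simp add: divide_right_mono)
  moreover have "sin x * cos x / (cos x)^2 = tan x"
    using c by (simp add: tan_def power2_eq_square)
  moreover have "x / (cos x)^2 = x * (1 + (tan x)^2)"
    using c tan_sec[of x] by (simp add: divide_inverse power_inverse)
  ultimately show ?thesis by simp
qed

lemma three_tan_minus_le:
  fixes x :: real
  assumes "0 \<le> x" "x < pi/2"
  shows "3 * (tan x - x) \<le> x * (tan x)^2"
proof -
  have "x * (tan x)^2 - 3 * (tan x - x) \<ge> 0"
  proof (rule nonneg_if_deriv_nonneg[where x = x and b = "pi/2"
        and F' = "\<lambda>y. 2 * tan y * (y * (1 + (tan y)^2) - tan y)"])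
    fix y :: real assume y: "0 \<le> y" "y < pi/2"
    then have "cos y \<noteq> 0" using cos_pos_0_pi_half[of y] by simp
    then show "((\<lambda>y. y * (tan y)^2 - 3 * (tan y - y)) has_real_derivative
        2 * tan y * (y * (1 + (tan y)^2) - tan y)) (at y)"
      by (auto intro!: derivative_eq_intros simp: inverse_cos_squared)
         (simp add: algebra_simps power2_eq_square)
    show "2 * tan y * (y * (1 + (tan y)^2) - tan y) \<ge> 0"
      using tan_nonneg_0_pi_half[OF y] tan_le_mult_sec_squared[OF y] by simp
  qed (use assms in auto)
  then show ?thesis by simp
qed

lemma four_neg_ln_cos_remainder_le:
  assumes "0 \<le> x" "x < pi/2"
  shows "4 * neg_ln_cos_remainder x \<le> x * (tan x - x)"
proof -
  have "x * (tan x - x) - 4 * neg_ln_cos_remainder x \<ge> 0"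
  proof (rule nonneg_if_deriv_nonneg[where x = x and b = "pi/2"
        and F' = "\<lambda>y. y * (tan y)^2 - 3 * (tan y - y)"])
    fix y :: real assume y: "0 \<le> y" "y < pi/2"
    then have "cos y \<noteq> 0" using cos_pos_0_pi_half[of y] by simp
    then show "((\<lambda>y. y * (tan y - y) - 4 * neg_ln_cos_remainder y) has_real_derivative
        y * (tan y)^2 - 3 * (tan y - y)) (at y)"
      using y by (auto intro!: derivative_eq_intros DERIV_neg_ln_cos_remainder
          simp: inverse_cos_squared algebra_simps)
    show "y * (tan y)^2 - 3 * (tan y - y) \<ge> 0"
      using three_tan_minus_le[OF y] by simp
  qed (use assms in \<open>auto simp: neg_ln_cos_remainder_def\<close>)
  then show ?thesis by simp
qed

text \<open>The preceding bound says that the logarithmic derivative of the remainder is at least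
  \<open>4 / x\<close>, that of \<open>x^4\<close>, wherever the remainder is positive.\<close>

lemma neg_ln_cos_remainder_div_pow4_mono:
  assumes "0 < x" "x \<le> y" "y < pi/2"
  shows "neg_ln_cos_remainder x / x^4 \<le> neg_ln_cos_remainder y / y^4"
proof (rule DERIV_nonneg_imp_nondecreasing[OF assms(2)])
  fix z :: real assume z: "x \<le> z" "z \<le> y"
  let ?D = "(z * (tan z - z) - 4 * neg_ln_cos_remainder z) / z^5"
  have z0: "0 < z" "0 \<le> z" "z < pi/2" using z assms by auto
  have "((\<lambda>z. neg_ln_cos_remainder z / z^4) has_real_derivative
      ((tan z - z) * z^4 - neg_ln_cos_remainder z * (4 * z^3)) / (z^4 * z^4)) (at z)"
    using z0 by (auto intro!: derivative_eq_intros DERIV_neg_ln_cos_remainder)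
  also have "((tan z - z) * z^4 - neg_ln_cos_remainder z * (4 * z^3)) / (z^4 * z^4) = ?D"
    using z0 by (simp add: field_simps eval_nat_numeral)
  finally have "((\<lambda>z. neg_ln_cos_remainder z / z^4) has_real_derivative ?D) (at z)" .
  moreover have "?D \<ge> 0"
    using four_neg_ln_cos_remainder_le[OF z0(2,3)] z0 by simp
  ultimately show "\<exists>d. ((\<lambda>z. neg_ln_cos_remainder z / z^4) has_real_derivative d) (at z) \<and> 0 \<le> d"
    by blast
qed

lemma cos_eq_exp_neg_ln_cos_remainder:
  assumes "0 \<le> x" "x < pi/2"
  shows "cos x = exp (- (x^2 / 2) - neg_ln_cos_remainder x)"
  using cos_pos_0_pi_half[OF assms] by (simp add: neg_ln_cos_remainder_def)

theorem mainTheorem2: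
  fixes \<alpha> x :: real
  assumes "\<alpha> \<in> {0<..<pi/2}" and "x \<in> {0<..<\<alpha>}"
  shows "cos \<alpha> powr (x^2 / \<alpha>^2)
           \<le> cos \<alpha> powr (x^4 / \<alpha>^4) * exp ((x^4 - \<alpha>^2 * x^2) / (2 * \<alpha>^2))
       \<and> cos \<alpha> powr (x^4 / \<alpha>^4) * exp ((x^4 - \<alpha>^2 * x^2) / (2 * \<alpha>^2)) \<le> cos x
       \<and> cos x \<le> exp (- (x^2 / 2))"
proof -
  have a: "0 < \<alpha>" "0 \<le> \<alpha>" "\<alpha> < pi/2" and x: "0 < x" "0 \<le> x" "x < pi/2" "x < \<alpha>"
    using assms by auto
  let ?g = neg_ln_cos_remainder
  define s where "s = x^2 / \<alpha>^2"
  have s: "0 \<le> s" "s \<le> 1" "x^4 / \<alpha>^4 = s^2" "x^2 = s * \<alpha>^2"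
    using a x by (auto simp: s_def power_divide simp flip: power_mult intro: power_mono)
  have powr_cos: "cos \<alpha> powr r = exp (r * (- (\<alpha>^2 / 2) - ?g \<alpha>))" for r
    using cos_eq_exp_neg_ln_cos_remainder[OF a(2,3)] by (simp add: powr_def)
  have x4: "x^4 = s^2 * \<alpha>^4"
    using a s(3) by (simp add: field_simps)
  have e: "(x^4 - \<alpha>^2 * x^2) / (2 * \<alpha>^2) = (s^2 - s) * (\<alpha>^2 / 2)"
    unfolding x4 s(4) using a by (simp add: field_simps eval_nat_numeral)
  \<comment> \<open>The exponential factor replaces the term \<open>s^2 * \<alpha>^2 / 2\<close> coming from \<open>cos \<alpha>\<close> by
    \<open>s * \<alpha>^2 / 2 = x^2 / 2\<close>.\<close>
  have mid: "cos \<alpha> powr (x^4 / \<alpha>^4) * exp ((x^4 - \<alpha>^2 * x^2) / (2 * \<alpha>^2))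
      = exp (- (x^2 / 2) - s^2 * ?g \<alpha>)"
    unfolding e s(3) powr_cos exp_add[symmetric] by (simp add: s(4) field_simps)
  have left: "cos \<alpha> powr (x^2 / \<alpha>^2) = exp (- (x^2 / 2) - s * ?g \<alpha>)"
    unfolding s_def[symmetric] powr_cos by (simp add: s(4) algebra_simps)
  have g0: "?g \<alpha> \<ge> 0" "?g x \<ge> 0"
    using a x by (auto intro: neg_ln_cos_remainder_nonneg)
  have "s^2 * ?g \<alpha> \<le> s * ?g \<alpha>"
    using s g0 by (intro mult_right_mono) (auto simp: power2_eq_square mult_left_le)
  moreover have "?g x \<le> s^2 * ?g \<alpha>"
    using neg_ln_cos_remainder_div_pow4_mono[of x \<alpha>] a x
    by (simp add: s(3)[symmetric] field_simps)
  ultimately show ?thesis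
    unfolding mid left cos_eq_exp_neg_ln_cos_remainder[OF x(2,3)] using g0 by simp
qed

end
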